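(* Let $n\ge1$ and $m\ge 2$ be natural numbers such that there is a cardinal $\lambda$ with the property that every abelian group $G$ with at least $\lambda$ elements of order $m$ satisfies $G\rightarrow(n)^{\mathrm{FS}}_\omega$ (i.e. for every colouring $c:G\to\omega$ there is $X\subseteq G$ with $|X|=n$ such that $c$ is constant on $\mathrm{FS}(X)$). Then there exists an $n$-adequate pattern modulo $m$.
   Context: For a subset $X$ of an abelian group, $\mathrm{FS}(X)=\{\sum_{x\in F}x\mid F\subseteq X\text{ finite and nonempty}\}$. For $x\in(\mathbb Z/m\mathbb Z)^l$, $\sigma(x)$ denotes the finite sequence of the non-zero entries of $x$, listed in order of increasing index. An $n$-adequate pattern modulo $m$ is a sequence $(x_k\mid k<n)$ of pairwise distinct elements of $(\mathbb Z/m\mathbb Z)^l$ for some $l<\omega$ such that $\sigma$ takes a single value on $\mathrm{FS}(\{x_k\mid k<n\})$ (the set of sums $\sum_{k\in F}x_k$ over nonempty $F\subseteq n$). *)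

theory Defs
  imports "HOL-Algebra.Product_Groups" "HOL-Algebra.FiniteProduct" "HOL-Algebra.Multiplicative_Group"
begin

unbundle cardinal_syntax

text \<open>
  Abelian groups are multiplicatively written commutative groups, so the finite sum
  over \<open>F\<close> is \<open>finprod G (\<lambda>x. x) F\<close>.
\<close>

definition FS :: "('a, 'b) monoid_scheme \<Rightarrow> 'a set \<Rightarrow> 'a set" where
  "FS G X = {finprod G (\<lambda>x. x) F | F. F \<subseteq> X \<and> finite F \<and> F \<noteq> {}}"

text \<open>The partition relation \<open>G \<rightarrow> (n)\<close>, superscript FS, subscript \<open>\<omega>\<close>. Values of \<open>c\<close> outside
  \<open>carrier G\<close> play no role, since \<open>FS G X \<subseteq> carrier G\<close>.\<close>

definition FS_arrow_omega :: "('a, 'b) monoid_scheme \<Rightarrow> nat \<Rightarrow> bool" where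
  "FS_arrow_omega G n \<longleftrightarrow>
     (\<forall>c :: 'a \<Rightarrow> nat. \<exists>X. X \<subseteq> carrier G \<and> finite X \<and> card X = n \<and>
        (\<exists>k. \<forall>y \<in> FS G X. c y = k))"

definition elements_of_order :: "('a, 'b) monoid_scheme \<Rightarrow> nat \<Rightarrow> 'a set" where
  "elements_of_order G m = {x \<in> carrier G. group.ord G x = m}"

text \<open>The group of \<open>l\<close>-tuples over the integers modulo \<open>m\<close>; its elements are
  functions on \<open>{..<l}\<close> with values in \<open>{0..<int m}\<close> (for \<open>m > 0\<close>).\<close>

abbreviation zmod_power :: "nat \<Rightarrow> nat \<Rightarrow> (nat \<Rightarrow> int) monoid" where
  "zmod_power m l \<equiv> product_group {..<l} (\<lambda>_. integer_mod_group m)"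

definition sigma_seq :: "nat \<Rightarrow> (nat \<Rightarrow> int) \<Rightarrow> int list" where
  "sigma_seq l x = filter (\<lambda>a. a \<noteq> 0) (map x [0..<l])"

definition adequate_pattern :: "nat \<Rightarrow> nat \<Rightarrow> (nat \<Rightarrow> int) list \<Rightarrow> bool" where
  "adequate_pattern n m xs \<longleftrightarrow>
     (\<exists>l. set xs \<subseteq> carrier (zmod_power m l) \<and> length xs = n \<and> distinct xs \<and>
        (\<exists>s. \<forall>y \<in> FS (zmod_power m l) (set xs). sigma_seq l y = s))"

end

theory Submission
  imports Defs "HOL-Algebra.Weak_Morphisms" "HOL-Algebra.Free_Abelian_Groups"
begin

text \<open>
  Apply the hypothesis to the finitely supported functions from the given infinite type to
  the integers modulo \<open>m\<close>. Linearly order the index type and colour a function by its word of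
  non-zero values in increasing order of the index; there are countably many such words. A
  monochromatic set lives on finitely many coordinates, and restricting to these
  coordinates, enumerated increasingly, yields the pattern.
\<close>

section \<open>Finite sums, monochromatic sets and orders under homomorphisms\<close>

lemma finprod_hom:
  assumes "comm_group G" "comm_group K" "h \<in> hom G K" "F \<subseteq> carrier G" "inj_on h F"
  shows "h (finprod G (\<lambda>x. x) F) = finprod K (\<lambda>x. x) (h ` F)"
proof -
  interpret G: comm_group G by fact
  interpret K: comm_group K by fact
  interpret group_hom G K h by unfold_locales fact
  show ?thesis
  proof (cases "finite F")
    case True
    then show ?thesis using assms(4,5)
    proof (induction F rule: finite_induct)
      case (insert x F)
      have F: "F \<subseteq> carrier G" "x \<in> carrier G" "inj_on h F" using insert.prems by auto
      have hx: "h x \<notin> h ` F" using insert.hyps insert.prems by auto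
      have "h (finprod G (\<lambda>x. x) (insert x F)) = h x \<otimes>\<^bsub>K\<^esub> h (finprod G (\<lambda>x. x) F)"
        using F insert.hyps by (simp add: Pi_def subset_eq)
      also have "\<dots> = h x \<otimes>\<^bsub>K\<^esub> finprod K (\<lambda>x. x) (h ` F)"
        using insert.IH F by simp
      also have "\<dots> = finprod K (\<lambda>x. x) (insert (h x) (h ` F))"
        using insert.hyps hx F by (intro K.finprod_insert[symmetric]) auto
      finally show ?case by simp
    qed simp
  next
    case False
    \<comment> \<open>\<open>finprod\<close> over an infinite set is the unit by default, and
      injectivity keeps the image infinite.\<close>
    then have "infinite (h ` F)" using assms(5) finite_imageD by blast
    then show ?thesis using False by simp
  qed
qed

lemma FS_image_hom:
  assumes "comm_group G" "comm_group K" "h \<in> hom G K" "X \<subseteq> carrier G" "inj_on h X"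
  shows "FS K (h ` X) = h ` FS G X"
proof -
  have *: "h (finprod G (\<lambda>x. x) F) = finprod K (\<lambda>x. x) (h ` F)" if "F \<subseteq> X" for F
    using finprod_hom[OF assms(1-3)] that assms(4,5) inj_on_subset by (metis order_trans)
  show ?thesis
  proof (intro equalityI subsetI)
    fix y assume "y \<in> FS K (h ` X)"
    then obtain F' where F': "F' \<subseteq> h ` X" "finite F'" "F' \<noteq> {}" "y = finprod K (\<lambda>x. x) F'"
      by (auto simp: FS_def)
    then obtain F where "F \<subseteq> X" "finite F" "F' = h ` F" by (meson finite_subset_image)
    moreover from calculation have "finprod G (\<lambda>x. x) F \<in> FS G X" using F'(3) by (auto simp: FS_def)
    ultimately show "y \<in> h ` FS G X" using F'(4) *[of F] by (metis imageI)
  next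
    fix y assume "y \<in> h ` FS G X"
    then obtain F where F: "F \<subseteq> X" "finite F" "F \<noteq> {}" "y = h (finprod G (\<lambda>x. x) F)"
      by (auto simp: FS_def)
    then have "h ` F \<subseteq> h ` X" "finite (h ` F)" "h ` F \<noteq> {}" "y = finprod K (\<lambda>x. x) (h ` F)"
      using * by auto
    then show "y \<in> FS K (h ` X)" unfolding FS_def by blast
  qed
qed

lemma FS_subset_carrier:
  assumes "comm_group G" "X \<subseteq> carrier G"
  shows "FS G X \<subseteq> carrier G"
proof -
  interpret comm_group G by fact
  show ?thesis using assms(2) by (auto simp: FS_def intro!: finprod_closed)
qed

lemma subset_FS:
  assumes "comm_group G" "X \<subseteq> carrier G"
  shows "X \<subseteq> FS G X"
proof
  interpret comm_group G by fact
  fix x assume "x \<in> X"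
  then have "x = finprod G (\<lambda>x. x) {x}" "{x} \<subseteq> X" using assms(2) by auto
  then show "x \<in> FS G X" unfolding FS_def by blast
qed

lemma finite_FS: "finite X \<Longrightarrow> finite (FS G X)"
proof -
  assume "finite X"
  moreover have "FS G X \<subseteq> finprod G (\<lambda>x. x) ` Pow X" by (auto simp: FS_def)
  ultimately show ?thesis by (meson finite_Pow_iff finite_imageI finite_subset)
qed

text \<open>A colouring of \<open>K\<close> is pulled back along \<open>h\<close>, and the
  monochromatic set found in \<open>G\<close> is pushed forward.\<close>

lemma FS_arrow_omega_iso:
  assumes "comm_group G" "comm_group K" "h \<in> iso G K" "FS_arrow_omega G n"
  shows "FS_arrow_omega K n"
  unfolding FS_arrow_omega_def
proof
  fix c :: "_ \<Rightarrow> nat"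
  from assms(4) obtain X k where X: "X \<subseteq> carrier G" "finite X" "card X = n"
    "\<forall>y \<in> FS G X. c (h y) = k"
    unfolding FS_arrow_omega_def by (elim allE[of _ "\<lambda>x. c (h x)"]) blast
  have h: "h \<in> hom G K" "inj_on h (carrier G)" "h ` carrier G = carrier K"
    using assms(3) by (auto simp: iso_def bij_betw_def)
  then have inj: "inj_on h X" using X(1) inj_on_subset by blast
  then have "FS K (h ` X) = h ` FS G X" using FS_image_hom assms h X by blast
  moreover have "h ` X \<subseteq> carrier K" using h(3) X(1) by blast
  ultimately show "\<exists>X. X \<subseteq> carrier K \<and> finite X \<and> card X = n \<and> (\<exists>k. \<forall>y\<in>FS K X. c y = k)"
    using X inj by (intro exI[of _ "h ` X"]) (auto simp: card_image)
qed

lemma ord_inj_hom: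
  assumes "group G" "group K" "h \<in> hom G K" "inj_on h (carrier G)" "x \<in> carrier G"
  shows "group.ord K (h x) = group.ord G x"
proof -
  interpret group_hom G K h using assms by (simp add: group_hom_def group_hom_axioms_def)
  have "h x [^]\<^bsub>K\<^esub> k = \<one>\<^bsub>K\<^esub> \<longleftrightarrow> x [^]\<^bsub>G\<^esub> k = \<one>\<^bsub>G\<^esub>" for k :: nat
    using assms(4,5) by (metis G.nat_pow_closed G.one_closed hom_nat_pow hom_one inj_onD)
  then show ?thesis
    using assms(5) G.pow_eq_id H.ord_unique hom_closed by (metis (no_types, lifting))
qed

lemma comm_group_image_group:
  assumes "comm_group G" "inj_on f (carrier G)"
  shows "comm_group (image_group f G)"
  using comm_group.iso_imp_img_comm_group[OF assms(1) inj_imp_image_group_iso[OF assms(2)]]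
  by (simp add: image_group_def)

lemma comm_group_product_group:
  assumes "\<And>i. i \<in> I \<Longrightarrow> comm_group (G i)"
  shows "comm_group (product_group I G)"
proof (rule group.group_comm_groupI)
  show "group (product_group I G)" using assms by (simp add: comm_group.axioms)
  show "x \<otimes>\<^bsub>product_group I G\<^esub> y = y \<otimes>\<^bsub>product_group I G\<^esub> x"
    if "x \<in> carrier (product_group I G)" "y \<in> carrier (product_group I G)" for x y
    using that comm_monoid.m_comm[OF comm_group.axioms(1), OF assms]
    by (simp add: PiE_iff cong: restrict_cong)
qed

lemma comm_group_sum_group:
  assumes "\<And>i. i \<in> I \<Longrightarrow> comm_group (G i)"
  shows "comm_group (sum_group I G)"
proof (rule group.group_comm_groupI)
  have G: "group (G i)" if "i \<in> I" for i using assms[OF that] by (rule comm_group.axioms)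
  then show "group (sum_group I G)" by simp
  show "x \<otimes>\<^bsub>sum_group I G\<^esub> y = y \<otimes>\<^bsub>sum_group I G\<^esub> x"
    if "x \<in> carrier (sum_group I G)" "y \<in> carrier (sum_group I G)" for x y
    using that comm_monoid.m_comm[OF comm_group.axioms(1), OF assms]
    by (simp add: PiE_iff carrier_sum_group G cong: restrict_cong)
qed

section \<open>The direct sum of copies of the integers modulo \<open>m\<close>\<close>

abbreviation zmod_sum :: "nat \<Rightarrow> ('i \<Rightarrow> int) monoid" where
  "zmod_sum m \<equiv> sum_group UNIV (\<lambda>_. integer_mod_group m)"

lemma carrier_zmod_sum:
  "x \<in> carrier (zmod_sum m) \<longleftrightarrow>
    (\<forall>i. x i \<in> carrier (integer_mod_group m)) \<and> finite {i. x i \<noteq> 0}"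
  by (auto simp: carrier_sum_group PiE_iff)

text \<open>This allows the direct sum to be copied into the type \<open>'i\<close> itself. A
  finitely supported function is determined by its graph over the support, a finite subset of
  \<open>'i \<times> int\<close>; for infinite \<open>'i\<close> there are no more such subsets than
  elements of \<open>'i\<close>.\<close>

lemma ex_inj_on_zmod_sum:
  assumes "infinite (UNIV :: 'i set)"
  shows "\<exists>f :: ('i \<Rightarrow> int) \<Rightarrow> 'i. inj_on f (carrier (zmod_sum m))"
proof -
  define gr :: "('i \<Rightarrow> int) \<Rightarrow> ('i \<times> int) set" where "gr x = {(i, x i) | i. x i \<noteq> 0}" for x
  have "inj gr"
  proof (rule injI)
    fix x y assume eq: "gr x = gr y"
    have "x i = y i" for i
    proof -
      have "(i, x i) \<in> gr x \<longleftrightarrow> (i, x i) \<in> gr y" "(i, y i) \<in> gr x \<longleftrightarrow> (i, y i) \<in> gr y"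
        using eq by auto
      then show ?thesis by (auto simp: gr_def)
    qed
    then show "x = y" by blast
  qed
  moreover have "gr x \<in> Fpow UNIV" if "x \<in> carrier (zmod_sum m)" for x
  proof -
    have "gr x = (\<lambda>i. (i, x i)) ` {i. x i \<noteq> 0}" by (auto simp: gr_def)
    then show ?thesis using that by (simp add: Fpow_def carrier_zmod_sum)
  qed
  ultimately have "carrier (zmod_sum m :: ('i \<Rightarrow> int) monoid) \<lesssim> Fpow (UNIV :: ('i \<times> int) set)"
    unfolding lepoll_def by (intro exI[of _ gr]) (auto intro: inj_on_subset)
  also have "\<dots> \<approx> (UNIV :: ('i \<times> int) set)"
    using assms by (intro eqpoll_Fpow) (simp add: finite_prod)
  also have "\<dots> \<lesssim> (UNIV :: 'i set)"
  proof -
    have "|UNIV :: int set| \<le>o |UNIV :: 'i set|"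
      using assms by (simp flip: infinite_iff_card_of_countable)
    then have "|(UNIV :: 'i set) \<times> (UNIV :: int set)| \<le>o |UNIV :: 'i set|"
      using assms by (intro card_of_Times_ordLeq_infinite) auto
    then show ?thesis unfolding lepoll_def card_of_ordLeq by simp
  qed
  finally show ?thesis unfolding lepoll_def by blast
qed

text \<open>The embedding of a single coordinate is an injective homomorphism, so the order of 1
  modulo \<open>m\<close> is preserved.\<close>

lemma zmod_sum_unit_in_elements_of_order:
  assumes "m \<ge> 2"
  shows "(\<lambda>j. if j = i then 1 else 0) \<in> elements_of_order (zmod_sum m) m"
proof -
  define h where "h a = (\<lambda>j. if j = i then a else 0)" for a :: int
  have "h \<in> hom (integer_mod_group m) (zmod_sum m)"
    by (auto simp: hom_def h_def carrier_zmod_sum Pi_iff carrier_integer_mod_group fun_eq_iff)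
  moreover have "inj h" by (metis h_def injI)
  moreover have one: "1 \<in> carrier (integer_mod_group m)" using assms by simp
  moreover have "group.ord (integer_mod_group m) 1 = m"
    using one by (subst group.ord_unique) (auto simp: mod_eq_0_iff_dvd)
  ultimately have "group.ord (zmod_sum m) (h 1) = m" "h 1 \<in> carrier (zmod_sum m)"
    using ord_inj_hom[of "integer_mod_group m" "zmod_sum m" h 1] inj_on_subset[of h UNIV]
    by (auto intro: hom_in_carrier)
  then show ?thesis by (simp add: elements_of_order_def h_def)
qed

section \<open>From a monochromatic set to an adequate pattern\<close>

lemma (in linorder) filter_sorted_list_of_set:
  assumes "finite S"
  shows "filter P (sorted_list_of_set S) = sorted_list_of_set {i \<in> S. P i}"
  using assms by (intro sorted_distinct_set_unique) (auto intro: sorted_wrt_filter)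

text \<open>The analogue of \<open>sigma_seq\<close> for an arbitrary linearly ordered index type.
  Working in the locale leaves the order to be chosen later. For infinite support the value is the
  empty list.\<close>

definition (in linorder) support_word :: "('a \<Rightarrow> int) \<Rightarrow> int list" where
  "support_word x = map x (sorted_list_of_set {i. x i \<noteq> 0})"

text \<open>Deleting the zeros from the values along \<open>S\<close> leaves the values on the
  support, still in increasing order of the index; the choice of \<open>S\<close> around the support
  is immaterial.\<close>

lemma (in linorder) sigma_seq_eq_support_word:
  fixes x :: "'a \<Rightarrow> int"
  assumes "finite S" "{i. x i \<noteq> 0} \<subseteq> S"
  shows "sigma_seq (card S) (\<lambda>k\<in>{..<card S}. x (sorted_list_of_set S ! k)) = support_word x"
proof -
  let ?L = "sorted_list_of_set S"
  have "map (\<lambda>k\<in>{..<card S}. x (?L ! k)) [0..<card S] = map x ?L"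
    by (intro nth_equalityI) auto
  moreover have "filter (\<lambda>a. a \<noteq> 0) (map x ?L) = map x (filter (\<lambda>i. x i \<noteq> 0) ?L)"
    by (simp add: filter_map o_def)
  moreover have "{i \<in> S. x i \<noteq> 0} = {i. x i \<noteq> 0}" using assms(2) by auto
  ultimately show ?thesis
    using assms(1) by (simp add: sigma_seq_def support_word_def filter_sorted_list_of_set)
qed

lemma (in linorder) adequate_pattern_of_FS_arrow_omega:
  assumes "FS_arrow_omega (zmod_sum m :: ('a \<Rightarrow> int) monoid) n"
  shows "\<exists>xs. adequate_pattern n m xs"
proof -
  let ?H = "zmod_sum m :: ('a \<Rightarrow> int) monoid"
  \<comment> \<open>Integer words are countable, so \<open>to_nat\<close> turns them into colours in
    the natural numbers.\<close>
  have "\<exists>X. X \<subseteq> carrier ?H \<and> finite X \<and> card X = n \<and>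
      (\<exists>k. \<forall>y \<in> FS ?H X. to_nat (support_word y) = k)"
    using assms unfolding FS_arrow_omega_def by (rule spec)
  then obtain X k where X: "X \<subseteq> carrier ?H" "finite X" "card X = n"
    and k: "\<forall>y \<in> FS ?H X. to_nat (support_word y) = k"
    by blast
  have H: "comm_group ?H" by (intro comm_group_sum_group) simp
  \<comment> \<open>Taking the supports of all the sums, not just of the members of
    \<open>X\<close>, makes the word lemma apply to each sum at once.\<close>
  define S where "S = (\<Union>x\<in>FS ?H X. {i. x i \<noteq> 0})"
  have finS: "finite S"
    unfolding S_def using FS_subset_carrier[OF H X(1)] finite_FS[OF X(2)]
    by (auto simp: subset_iff carrier_zmod_sum)
  define l L where "l = card S" and "L = sorted_list_of_set S"
  have L: "set L = S" "length L = l" using finS by (auto simp: L_def l_def)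
  define r :: "('a \<Rightarrow> int) \<Rightarrow> nat \<Rightarrow> int" where "r x = (\<lambda>k\<in>{..<l}. x (L ! k))" for x
  have K: "comm_group (zmod_power m l)" by (intro comm_group_product_group) simp
  have r: "r \<in> hom ?H (zmod_power m l)"
  proof (rule homI)
    show "r x \<in> carrier (zmod_power m l)" if "x \<in> carrier ?H" for x
      using that by (simp add: r_def carrier_zmod_sum)
    show "r (x \<otimes>\<^bsub>?H\<^esub> y) = r x \<otimes>\<^bsub>zmod_power m l\<^esub> r y" for x y
      by (rule ext) (simp add: r_def)
  qed
  \<comment> \<open>Members of \<open>X\<close> are themselves sums, over singletons, so they vanish
    off \<open>S\<close> and are determined by their values on it.\<close>
  have inj: "inj_on r X"
  proof (rule inj_onI)
    fix x y assume xy: "x \<in> X" "y \<in> X" "r x = r y"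
    have "x i = y i" for i
    proof (cases "i \<in> S")
      case True
      then obtain j where "j < l" "L ! j = i" using L by (metis in_set_conv_nth)
      then show ?thesis using fun_cong[OF xy(3), of j] by (simp add: r_def)
    next
      case False
      moreover have "x \<in> FS ?H X" "y \<in> FS ?H X" using xy(1,2) subset_FS[OF H X(1)] by blast+
      ultimately have "x i = 0" "y i = 0" unfolding S_def by blast+
      then show ?thesis by simp
    qed
    then show "x = y" by blast
  qed
  \<comment> \<open>Decoding the colour \<open>k\<close> recovers the common word.\<close>
  have sig: "sigma_seq l (r y) = from_nat k" if "y \<in> FS ?H X" for y
  proof -
    have "sigma_seq l (r y) = support_word y"
      unfolding l_def r_def L_def using finS that
      by (intro sigma_seq_eq_support_word) (auto simp: S_def)
    then show ?thesis using k that by (metis from_nat_to_nat)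
  qed
  \<comment> \<open>Any enumeration will do, since the sums depend only on the underlying
    set.\<close>
  obtain xs where xs: "set xs = r ` X" "distinct xs"
    using finite_distinct_list[OF finite_imageI[OF X(2), of r]] by blast
  have "length xs = n" using distinct_card[OF xs(2)] card_image[OF inj] xs(1) X(3) by simp
  moreover have "r ` X \<subseteq> carrier (zmod_power m l)" using hom_in_carrier[OF r] X(1) by blast
  moreover have "\<forall>y \<in> FS (zmod_power m l) (r ` X). sigma_seq l y = from_nat k"
    using FS_image_hom[OF H K r X(1) inj] sig by auto
  ultimately have "adequate_pattern n m xs"
    unfolding adequate_pattern_def using xs
    by (intro exI[of _ l] conjI exI[of _ "from_nat k"]) simp_all
  then show ?thesis ..
qed

section \<open>Ordering the index type and conclusion\<close>

text \<open>A well-order exists by the axiom of choice; only its linearity is kept.\<close>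

lemma ex_linorder: "\<exists>le lt. class.linorder (le :: 'a \<Rightarrow> 'a \<Rightarrow> bool) lt"
proof -
  obtain R :: "'a rel" where "well_order_on UNIV R" using well_order_on by blast
  then have "linear_order_on UNIV R" by (simp add: well_order_on_def)
  then have R: "refl R" "trans R" "antisym R" "total R"
    by (auto simp: linear_order_on_def partial_order_on_def preorder_on_def)
  have "class.linorder (\<lambda>x y. (x, y) \<in> R) (\<lambda>x y. (x, y) \<in> R \<and> (y, x) \<notin> R)"
  proof
    fix x y z
    show "(x, x) \<in> R" using R(1) by (simp add: refl_on_def)
    show "(x, y) \<in> R \<Longrightarrow> (y, z) \<in> R \<Longrightarrow> (x, z) \<in> R" using R(2) by (rule transD)
    show "(x, y) \<in> R \<Longrightarrow> (y, x) \<in> R \<Longrightarrow> x = y" using R(3) by (rule antisymD)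
    show "(x, y) \<in> R \<or> (y, x) \<in> R" using R(1,4) by (metis refl_on_def total_on_def UNIV_I)
  qed simp
  then show ?thesis by blast
qed

theorem theorem3p5:
  fixes n m :: nat
  assumes "n \<ge> 1" and "m \<ge> 2"
    and "infinite (UNIV :: 'g set)"
    and "\<exists>lam :: 'g rel. Card_order lam \<and>
           (\<forall>G :: 'g monoid. comm_group G \<and> lam \<le>o |elements_of_order G m| \<longrightarrow>
              FS_arrow_omega G n)"
  shows "\<exists>xs. adequate_pattern n m xs"
proof -
  let ?H = "zmod_sum m :: ('g \<Rightarrow> int) monoid"
  have H: "comm_group ?H" by (intro comm_group_sum_group) simp
  obtain f :: "('g \<Rightarrow> int) \<Rightarrow> 'g" where f: "inj_on f (carrier ?H)"
    using ex_inj_on_zmod_sum[OF assms(3)] by blast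
  \<comment> \<open>The hypothesis speaks only of groups on the type \<open>'g\<close>, so it is
    applied to the copy of \<open>?H\<close> along \<open>f\<close>.\<close>
  let ?G = "image_group f ?H"
  have G: "comm_group ?G" using comm_group_image_group[OF H f] .
  have iso: "f \<in> iso ?H ?G" using inj_imp_image_group_iso[OF f] .
  \<comment> \<open>The unit vectors supply as many elements of order \<open>m\<close> as
    \<open>'g\<close> has elements.\<close>
  define e :: "'g \<Rightarrow> 'g \<Rightarrow> int" where "e i = (\<lambda>j. if j = i then 1 else 0)" for i
  have e: "e i \<in> elements_of_order ?H m" for i
    using zmod_sum_unit_in_elements_of_order[OF assms(2)] by (simp add: e_def)
  then have e_carrier: "e i \<in> carrier ?H" for i by (simp add: elements_of_order_def)
  have "f (e i) \<in> elements_of_order ?G m" for i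
    using e[of i] ord_inj_hom[of ?H ?G f "e i"] iso f G H
    by (auto simp: elements_of_order_def iso_def hom_def comm_group.axioms)
  moreover have "inj (\<lambda>i. f (e i))"
  proof (rule injI)
    fix i j assume "f (e i) = f (e j)"
    then have "e i i = e j i" using inj_onD[OF f] e_carrier by metis
    then show "i = j" by (simp add: e_def split: if_splits)
  qed
  ultimately have card: "|UNIV :: 'g set| \<le>o |elements_of_order ?G m|"
    by (intro card_of_ordLeqI[of "\<lambda>i. f (e i)"]) auto
  obtain lam :: "'g rel" where lam: "Card_order lam"
    "\<And>G :: 'g monoid. comm_group G \<Longrightarrow> lam \<le>o |elements_of_order G m| \<Longrightarrow> FS_arrow_omega G n"
    using assms(4) by blast
  \<comment> \<open>A cardinal represented by a relation on \<open>'g\<close> is at most the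
    cardinality of \<open>'g\<close>, so \<open>?G\<close> has enough elements of order
    \<open>m\<close>.\<close>
  have "lam \<le>o |UNIV :: 'g set|"
    using lam(1) by (meson card_of_Field_ordIso card_of_UNIV ordIso_ordLeq_trans ordIso_symmetric)
  then have "FS_arrow_omega ?G n" using lam(2)[OF G] card ordLeq_transitive by blast
  \<comment> \<open>The relation returns to \<open>?H\<close> along the inverse of
    \<open>f\<close>.\<close>
  then have "FS_arrow_omega ?H n"
    using FS_arrow_omega_iso[OF G H group.iso_set_sym[OF comm_group.axioms(2)[OF H] iso]] by blast
  moreover obtain le lt :: "'g \<Rightarrow> 'g \<Rightarrow> bool" where "class.linorder le lt"
    using ex_linorder by blast
  ultimately show ?thesis by (intro linorder.adequate_pattern_of_FS_arrow_omega)
qed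

end
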